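(* Let $\alpha\in(0,\infty)$. Suppose that $\mathcal{P}$ is an $\alpha$-convex set of probability distributions on a measurable space $(\mathcal{X},\mathcal{F})$. Let $Q$ be an arbitrary probability distribution on $(\mathcal{X},\mathcal{F})$ and suppose that the $\alpha$-information projection $$P^\ast=\operatorname*{arg\,min}_{P\in\mathcal{P}} D_\alpha(P\|Q)$$ exists (that is, $P^\ast\in\mathcal{P}$ and $D_\alpha(P^\ast\|Q)\le D_\alpha(P\|Q)$ for all $P\in\mathcal{P}$). Then $$D_\alpha(P\|Q)\ \geq\ D_\alpha(P\|P^\ast)+D_\alpha(P^\ast\|Q)\qquad\text{for all } P\in\mathcal{P}.$$
   Context: All distributions are assumed absolutely continuous with respect to a common $\sigma$-finite measure $\mu$ (nothing depends on its choice); lower-case letters denote densities with respect to $\mu$. Rényi divergence: for $\alpha\in(0,1)\cup(1,\infty)$, $D_\alpha(P\|Q)=\frac{1}{\alpha-1}\ln\int p^\alpha q^{1-\alpha}\,d\mu\in[0,\infty]$, where for $\alpha>1$ one reads $p^\alpha q^{1-\alpha}$ as $p^\alpha/q^{\alpha-1}$ with the conventions $0/0=0$ and $x/0=\infty$ for $x>0$. For $\alpha=1$, $D_1(P\|Q)=\lim_{\alpha\uparrow1}D_\alpha(P\|Q)$, which is the Kullback-Leibler divergence $\int p\ln\frac{p}{q}\,d\mu$ (with $0\ln(0/q)=0$ and $p\ln(p/0)=\infty$ if $p>0$). $(\alpha,\lambda)$-mixture: for probability distributions $P_1,P_2$ and a probability vector $\lambda=(\lambda_1,\lambda_2)$, the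 $(\alpha,\lambda)$-mixture $P_\lambda$ of $P_1$ and $P_2$ is the distribution with density $$p_\lambda=\frac{(\lambda_1p_1^\alpha+\lambda_2p_2^\alpha)^{1/\alpha}}{Z},\qquad Z=\int(\lambda_1p_1^\alpha+\lambda_2p_2^\alpha)^{1/\alpha}\,d\mu$$ (the constant $Z$ is always in $(0,\infty)$). A set $\mathcal{P}$ of distributions is $\alpha$-convex if, for any probability vector $\lambda=(\lambda_1,\lambda_2)$ and any $P_1,P_2\in\mathcal{P}$, the $(\alpha,\lambda)$-mixture of $P_1$ and $P_2$ also belongs to $\mathcal{P}$. *)

theory Defs
  imports "HOL-Probability.Probability"
begin

definition distributions :: "'a measure \<Rightarrow> 'a measure set" where
  "distributions \<mu> = {P. prob_space P \<and> sets P = sets \<mu> \<and> absolutely_continuous \<mu> P}"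

text \<open>For P in \<^term>\<open>distributions \<mu>\<close> with \<open>\<mu>\<close> sigma-finite, the derivative is finite
  almost everywhere, so the conversion to \<^typ>\<open>real\<close> changes the density on a null set only.\<close>

definition pdf :: "'a measure \<Rightarrow> 'a measure \<Rightarrow> 'a \<Rightarrow> real" where
  "pdf \<mu> P x = enn2real (RN_deriv \<mu> P x)"

definition ext_ln :: "ennreal \<Rightarrow> ereal" where
  "ext_ln x = (if x = 0 then -\<infinity> else if x = top then \<infinity> else ereal (ln (enn2real x)))"

text \<open>For \<open>\<alpha> > 1\<close> the quotient is taken in \<^typ>\<open>ennreal\<close>, where \<open>0 / 0 = 0\<close> and
  \<open>x / 0 = top\<close> for \<open>x > 0\<close>.\<close>

definition renyi_integral :: "'a measure \<Rightarrow> real \<Rightarrow> 'a measure \<Rightarrow> 'a measure \<Rightarrow> ennreal" where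
  "renyi_integral \<mu> \<alpha> P Q =
     (if \<alpha> < 1
      then (\<integral>\<^sup>+x. ennreal (pdf \<mu> P x powr \<alpha> * pdf \<mu> Q x powr (1 - \<alpha>)) \<partial>\<mu>)
      else (\<integral>\<^sup>+x. ennreal (pdf \<mu> P x powr \<alpha>) / ennreal (pdf \<mu> Q x powr (\<alpha> - 1)) \<partial>\<mu>))"

definition renyi_simple :: "'a measure \<Rightarrow> real \<Rightarrow> 'a measure \<Rightarrow> 'a measure \<Rightarrow> ereal" where
  "renyi_simple \<mu> \<alpha> P Q = ereal (1 / (\<alpha> - 1)) * ext_ln (renyi_integral \<mu> \<alpha> P Q)"

text \<open>Meaningful for orders \<open>\<alpha> > 0\<close>; order 1 is the limit from below.\<close>

definition renyi_divergence :: "'a measure \<Rightarrow> real \<Rightarrow> 'a measure \<Rightarrow> 'a measure \<Rightarrow> ereal" where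
  "renyi_divergence \<mu> \<alpha> P Q =
     (if \<alpha> = 1 then Lim (at_left 1) (\<lambda>a. renyi_simple \<mu> a P Q)
      else renyi_simple \<mu> \<alpha> P Q)"

definition mixture_numerator ::
  "'a measure \<Rightarrow> real \<Rightarrow> real \<Rightarrow> real \<Rightarrow> 'a measure \<Rightarrow> 'a measure \<Rightarrow> 'a \<Rightarrow> real" where
  "mixture_numerator \<mu> \<alpha> l1 l2 P1 P2 x =
     (l1 * pdf \<mu> P1 x powr \<alpha> + l2 * pdf \<mu> P2 x powr \<alpha>) powr (1 / \<alpha>)"

definition alpha_mixture ::
  "'a measure \<Rightarrow> real \<Rightarrow> real \<Rightarrow> real \<Rightarrow> 'a measure \<Rightarrow> 'a measure \<Rightarrow> 'a measure" where
  "alpha_mixture \<mu> \<alpha> l1 l2 P1 P2 =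
     density \<mu> (\<lambda>x. ennreal (mixture_numerator \<mu> \<alpha> l1 l2 P1 P2 x) /
                    (\<integral>\<^sup>+y. ennreal (mixture_numerator \<mu> \<alpha> l1 l2 P1 P2 y) \<partial>\<mu>))"

definition alpha_convex :: "'a measure \<Rightarrow> real \<Rightarrow> 'a measure set \<Rightarrow> bool" where
  "alpha_convex \<mu> \<alpha> \<P> \<longleftrightarrow>
     (\<forall>l1 l2. 0 \<le> l1 \<and> 0 \<le> l2 \<and> l1 + l2 = 1 \<longrightarrow>
        (\<forall>P1\<in>\<P>. \<forall>P2\<in>\<P>. alpha_mixture \<mu> \<alpha> l1 l2 P1 P2 \<in> \<P>))"

definition is_alpha_projection ::
  "'a measure \<Rightarrow> real \<Rightarrow> 'a measure set \<Rightarrow> 'a measure \<Rightarrow> 'a measure \<Rightarrow> bool" where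
  "is_alpha_projection \<mu> \<alpha> \<P> Q R \<longleftrightarrow>
     R \<in> \<P> \<and> (\<forall>P\<in>\<P>. renyi_divergence \<mu> \<alpha> R Q \<le> renyi_divergence \<mu> \<alpha> P Q)"

end

theory Submission
  imports Defs "HOL-Real_Asymp.Real_Asymp"
begin

text \<open>Let \<open>s\<^sub>t\<close> be the unnormalised density of the mixture of \<open>P\<^sup>*\<close> and \<open>P\<close> with weights
  \<open>1 - t\<close> and \<open>t\<close>, and \<open>Z\<^sub>t\<close> its integral. For \<open>\<alpha> \<noteq> 1\<close> the Renyi integral \<open>F\<close> relative to \<open>Q\<close> is
  linear in \<open>\<alpha>\<close>-th powers of densities, so the mixture has
  \<open>F = ((1 - t) F(P\<^sup>*) + t F(P)) / Z\<^sub>t\<^sup>\<alpha>\<close>. With \<open>c = F(P) / F(P\<^sup>*)\<close>, optimality of \<open>P\<^sup>*\<close> and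
  Bernoulli's inequality give \<open>Z\<^sub>t \<le> 1 + t (c - 1) / \<alpha>\<close> for \<open>\<alpha> > 1\<close>, and the reverse for \<open>\<alpha> < 1\<close>.
  Since \<open>s\<^sub>t\<close> lies above (below) the chord \<open>(1 - t) p\<^sup>* + t p\<close>, Fatou's lemma for the difference
  quotients of \<open>s\<^sub>t\<close> at \<open>t = 0\<close> compares \<open>c\<close> with the integral of \<open>p\<close> to the power \<open>\<alpha>\<close> times
  \<open>p\<^sup>*\<close> to the power \<open>1 - \<alpha>\<close>, and taking logarithms proves the claim.

  For \<open>\<alpha> = 1\<close> the limit defining the divergence is first identified with the Kullback-Leibler
  divergence \<open>K\<close>. Then the compensation inequality
  \<open>K(P\<^sub>t, Q) + t K(P, P\<^sub>t) \<le> (1 - t) K(P\<^sup>*, Q) + t K(P, Q)\<close> and optimality yield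
  \<open>K(P, P\<^sub>t) + K(P\<^sup>*, Q) \<le> K(P, Q)\<close>, and Fatou's lemma lets \<open>t\<close> tend to \<open>0\<close>.\<close>

section \<open>Power means of two numbers\<close>

text \<open>The first number carries the weight 1 - t, so t = 0 returns it when it is nonnegative
  and \<alpha> > 0. It will be the density of the projection, and t measures the step towards a
  competitor.\<close>

definition power_mean :: "real \<Rightarrow> real \<Rightarrow> real \<Rightarrow> real \<Rightarrow> real" where
  "power_mean \<alpha> t x y = ((1 - t) * x powr \<alpha> + t * y powr \<alpha>) powr (1 / \<alpha>)"

lemma power_mean_nonneg [simp]: "0 \<le> power_mean \<alpha> t x y"
  by (simp add: power_mean_def)

lemma borel_measurable_power_mean [measurable]:
  assumes [measurable]: "f \<in> borel_measurable M" "g \<in> borel_measurable M"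
  shows "(\<lambda>x. power_mean \<alpha> t (f x) (g x)) \<in> borel_measurable M"
  unfolding power_mean_def by measurable

lemma power_mean_powr:
  assumes "0 < \<alpha>" "0 \<le> t" "t \<le> 1"
  shows "power_mean \<alpha> t x y powr \<alpha> = (1 - t) * x powr \<alpha> + t * y powr \<alpha>"
  using assms by (simp add: power_mean_def powr_powr)

lemma power_mean_one:
  assumes "0 \<le> t" "t \<le> 1" "0 \<le> x" "0 \<le> y"
  shows "power_mean 1 t x y = (1 - t) * x + t * y"
  using assms by (simp add: power_mean_def)

text \<open>For positive numbers this is convexity of the power function. If one number vanishes, a
  single scaled term is left and s powr p \<le> s for s in [0, 1] suffices.\<close>

lemma powr_convex_combination_le:
  fixes x y p t :: real
  assumes "1 \<le> p" "0 \<le> x" "0 \<le> y" "0 \<le> t" "t \<le> 1"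
  shows "((1 - t) * x + t * y) powr p \<le> (1 - t) * x powr p + t * y powr p"
proof -
  have scale: "(s * z) powr p \<le> s * z powr p" if "0 \<le> s" "s \<le> 1" "0 \<le> z" for s z :: real
  proof -
    have "s powr p \<le> s"
      using that assms(1) powr_mono'[of 1 p s] by simp
    then show ?thesis
      using that by (simp add: powr_mult mult_right_mono)
  qed
  consider "x = 0" | "y = 0" | "0 < x" "0 < y"
    using assms by linarith
  then show ?thesis
  proof cases
    case 3
    then show ?thesis
      using convex_onD[OF powr_convex[OF assms(1)], of t x y] assms by simp
  qed (use scale assms in auto)
qed

lemma power_mean_ge:
  assumes "1 \<le> \<alpha>" "0 \<le> t" "t \<le> 1" "0 \<le> x" "0 \<le> y"
  shows "(1 - t) * x + t * y \<le> power_mean \<alpha> t x y"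
proof -
  have "(((1 - t) * x + t * y) powr \<alpha>) powr (1 / \<alpha>) \<le> power_mean \<alpha> t x y"
    unfolding power_mean_def
    by (intro powr_mono2 powr_convex_combination_le) (use assms in auto)
  then show ?thesis
    using assms by (simp add: powr_powr)
qed

text \<open>Convexity is used for the exponent 1 / \<alpha>, which is at least 1, and applied to the
  \<alpha>-th powers.\<close>

lemma power_mean_le:
  assumes "0 < \<alpha>" "\<alpha> \<le> 1" "0 \<le> t" "t \<le> 1" "0 \<le> x" "0 \<le> y"
  shows "power_mean \<alpha> t x y \<le> (1 - t) * x + t * y"
  using powr_convex_combination_le[of "1 / \<alpha>" "x powr \<alpha>" "y powr \<alpha>" t] assms
  by (simp add: power_mean_def powr_powr)

text \<open>A crude bound uniform in \<alpha> and t, obtained by replacing both numbers by their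
  sum. It makes the normalising constant of a mixture finite.\<close>

lemma power_mean_le_add:
  assumes "0 < \<alpha>" "0 \<le> t" "t \<le> 1" "0 \<le> x" "0 \<le> y"
  shows "power_mean \<alpha> t x y \<le> x + y"
proof -
  have "(1 - t) * x powr \<alpha> + t * y powr \<alpha> \<le> (1 - t) * (x + y) powr \<alpha> + t * (x + y) powr \<alpha>"
    by (intro add_mono mult_left_mono powr_mono2) (use assms in auto)
  also have "\<dots> = (x + y) powr \<alpha>" by (simp add: algebra_simps)
  finally have "power_mean \<alpha> t x y \<le> ((x + y) powr \<alpha>) powr (1 / \<alpha>)"
    unfolding power_mean_def by (intro powr_mono2) (use assms in auto)
  then show ?thesis
    using assms by (simp add: powr_powr)
qed

text \<open>The right derivative at t = 0 contains the integrand of the Renyi integral of order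
  \<alpha>. Positivity of x lets the outer power be differentiated at x powr \<alpha>.\<close>

lemma power_mean_derivative:
  assumes "0 < \<alpha>" "0 < x"
  shows "((\<lambda>t. (power_mean \<alpha> t x y - x) / t) \<longlongrightarrow> (y powr \<alpha> * x powr (1 - \<alpha>) - x) / \<alpha>) (at_right 0)"
proof -
  have "((\<lambda>t. power_mean \<alpha> t x y) has_real_derivative
      1 / \<alpha> * (x powr \<alpha>) powr (1 / \<alpha> - 1) * (y powr \<alpha> - x powr \<alpha>)) (at 0)"
    unfolding power_mean_def using assms
    by (auto intro!: derivative_eq_intros)
  also have "1 / \<alpha> * (x powr \<alpha>) powr (1 / \<alpha> - 1) * (y powr \<alpha> - x powr \<alpha>)
      = (y powr \<alpha> * x powr (1 - \<alpha>) - x) / \<alpha>"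
  proof -
    have "(x powr \<alpha>) powr (1 / \<alpha> - 1) = x powr (1 - \<alpha>)"
      using assms by (simp add: powr_powr algebra_simps)
    moreover have "x powr (1 - \<alpha>) * x powr \<alpha> = x"
      using assms by (simp flip: powr_add)
    ultimately show ?thesis
      by (simp add: algebra_simps diff_divide_distrib)
  qed
  finally have "((\<lambda>t. (power_mean \<alpha> t x y - power_mean \<alpha> 0 x y) / (t - 0))
      \<longlongrightarrow> (y powr \<alpha> * x powr (1 - \<alpha>) - x) / \<alpha>) (at 0)"
    unfolding has_field_derivative_iff .
  moreover have "power_mean \<alpha> 0 x y = x"
    using assms by (simp add: power_mean_def powr_powr)
  ultimately show ?thesis
    by (simp add: filterlim_at_split)
qed

text \<open>Bernoulli's inequality, as the weighted AM-GM inequality for x and 1 with weights p and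
  1 - p. The next lemma follows by inserting x powr p with exponent 1 / p.\<close>

lemma powr_le_tangent:
  fixes x p :: real
  assumes "0 < p" "p \<le> 1" "0 \<le> x"
  shows "x powr p \<le> 1 + p * (x - 1)"
proof (cases "x = 0")
  case False
  then show ?thesis
    using Youngs_inequality_0[of p "1 - p" x 1] assms by (simp add: algebra_simps)
qed (use assms in simp)

lemma powr_ge_tangent:
  fixes x p :: real
  assumes "1 \<le> p" "0 \<le> x"
  shows "1 + p * (x - 1) \<le> x powr p"
  using powr_le_tangent[of "1 / p" "x powr p"] assms
  by (simp add: powr_powr field_simps)

section \<open>Differentiating the integral of a power mean\<close>

lemma nn_integral_le_liminf:
  assumes "\<And>n. u n \<in> borel_measurable M"
    and "\<And>x. x \<in> space M \<Longrightarrow> (\<lambda>n. u n x) \<longlonglongrightarrow> f x"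
  shows "(\<integral>\<^sup>+x. f x \<partial>M) \<le> liminf (\<lambda>n. \<integral>\<^sup>+x. u n x \<partial>M)"
proof -
  have "(\<integral>\<^sup>+x. f x \<partial>M) = (\<integral>\<^sup>+x. liminf (\<lambda>n. u n x) \<partial>M)"
    using assms(2)
    by (intro nn_integral_cong lim_imp_Liminf[symmetric] trivial_limit_sequentially)
  also have "\<dots> \<le> liminf (\<lambda>n. \<integral>\<^sup>+x. u n x \<partial>M)"
    by (rule nn_integral_liminf) (rule assms(1))
  finally show ?thesis .
qed

lemma nn_integral_le_at_right:
  fixes u :: "real \<Rightarrow> 'a \<Rightarrow> ennreal"
  assumes "\<And>t. u t \<in> borel_measurable M"
    and "\<And>x. x \<in> space M \<Longrightarrow> ((\<lambda>t. u t x) \<longlongrightarrow> f x) (at_right 0)"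
    and "\<And>t. 0 < t \<Longrightarrow> t < 1 \<Longrightarrow> (\<integral>\<^sup>+x. u t x \<partial>M) \<le> C"
  shows "(\<integral>\<^sup>+x. f x \<partial>M) \<le> C"
proof -
  \<comment> \<open>The shift by 2 keeps every \<open>s n\<close> strictly inside (0, 1), also for n
    = 0, where the bound on the integrals is assumed.\<close>
  define s where "s = (\<lambda>n. 1 / (real n + 2))"
  have s: "filterlim s (at_right 0) sequentially"
    unfolding s_def by real_asymp
  have "(\<integral>\<^sup>+x. f x \<partial>M) \<le> liminf (\<lambda>n. \<integral>\<^sup>+x. u (s n) x \<partial>M)"
    using assms(1) filterlim_compose[OF assms(2) s] by (intro nn_integral_le_liminf) auto
  also have "\<dots> \<le> liminf (\<lambda>n. C)"
    by (intro Liminf_mono always_eventually allI assms(3)) (auto simp: s_def field_simps)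
  finally show ?thesis by (simp add: Liminf_const)
qed

text \<open>The quotient equals y * t powr (1 / \<alpha> - 1), whose exponent is negative. This
  infinite slope matches the convention x / 0 = \<infinity>.\<close>

lemma power_mean_derivative_at_zero:
  assumes "1 < \<alpha>" "0 < y"
  shows "filterlim (\<lambda>t. power_mean \<alpha> t 0 y / t) at_top (at_right 0)"
proof -
  have "filterlim (\<lambda>t. t powr (1 / \<alpha> - 1)) at_top (at_right (0::real))"
    using assms by real_asymp
  then have "filterlim (\<lambda>t. y * t powr (1 / \<alpha> - 1)) at_top (at_right (0::real))"
    using assms(2) by (intro filterlim_tendsto_pos_mult_at_top[OF tendsto_const])
  moreover have "\<forall>\<^sub>F t in at_right (0::real). y * t powr (1 / \<alpha> - 1) = power_mean \<alpha> t 0 y / t"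
    using eventually_at_right_less[of 0]
    by eventually_elim
      (use assms in \<open>simp add: power_mean_def powr_mult powr_powr powr_diff mult.commute\<close>)
  ultimately show ?thesis
    using filterlim_cong[OF refl refl] by fast
qed

text \<open>Here f is the density of the projection and g that of a competitor. By Fatou's lemma a
  bound on the mass of the mean that is linear in t passes to the derivative at t = 0, whose main
  term is the integrand of the claim divided by \<alpha>.\<close>

lemma nn_integral_le_of_power_mean_le:
  fixes f g :: "'a \<Rightarrow> real"
  assumes "1 < \<alpha>"
    and [measurable]: "f \<in> borel_measurable M" "g \<in> borel_measurable M"
    and nonneg: "\<And>x. 0 \<le> f x" "\<And>x. 0 \<le> g x"
    and f1: "(\<integral>\<^sup>+x. f x \<partial>M) = 1"
    and bound: "\<And>t. 0 < t \<Longrightarrow> t < 1 \<Longrightarrow>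
      (\<integral>\<^sup>+x. power_mean \<alpha> t (f x) (g x) \<partial>M) \<le> ennreal (1 + t * ((c - 1) / \<alpha>))"
  shows "(\<integral>\<^sup>+x. ennreal (g x powr \<alpha>) / ennreal (f x powr (\<alpha> - 1)) \<partial>M) \<le> ennreal c"
proof -
  \<comment> \<open>Subtracting (1 - t) f instead of f makes the quotient nonnegative, as Fatou's
    lemma requires. This adds f to the ordinary difference quotient, hence 1 to the bound.\<close>
  define u where "u = (\<lambda>t x. ennreal ((power_mean \<alpha> t (f x) (g x) - (1 - t) * f x) / t))"
  define w where "w = (\<lambda>x. ennreal (g x powr \<alpha>) / ennreal (f x powr (\<alpha> - 1)))"
  have [measurable]: "w \<in> borel_measurable M" "\<And>t. u t \<in> borel_measurable M"
    unfolding w_def u_def by measurable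
  have "(\<integral>\<^sup>+x. ennreal (1 / \<alpha>) * w x + ennreal (1 - 1 / \<alpha>) * ennreal (f x) \<partial>M)
      \<le> ennreal (1 + (c - 1) / \<alpha>)"
  proof (rule nn_integral_le_at_right)
    show "u t \<in> borel_measurable M" for t by measurable
  next
    fix x
    show "((\<lambda>t. u t x) \<longlongrightarrow> ennreal (1 / \<alpha>) * w x + ennreal (1 - 1 / \<alpha>) * ennreal (f x)) (at_right 0)"
    proof (cases "f x = 0")
      case False
      then have pos: "0 < f x" using nonneg(1)[of x] by simp
      have "((\<lambda>t. (power_mean \<alpha> t (f x) (g x) - f x) / t + f x) \<longlongrightarrow>
          (g x powr \<alpha> * f x powr (1 - \<alpha>) - f x) / \<alpha> + f x) (at_right 0)"
        using assms(1) pos by (intro tendsto_intros power_mean_derivative) auto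
      moreover have "\<forall>\<^sub>F t in at_right (0::real). (power_mean \<alpha> t (f x) (g x) - f x) / t + f x
          = (power_mean \<alpha> t (f x) (g x) - (1 - t) * f x) / t"
        using eventually_at_right_less[of 0] by eventually_elim (simp add: field_simps)
      ultimately have "((\<lambda>t. (power_mean \<alpha> t (f x) (g x) - (1 - t) * f x) / t) \<longlongrightarrow>
          (g x powr \<alpha> * f x powr (1 - \<alpha>) - f x) / \<alpha> + f x) (at_right 0)"
        by (rule Lim_transform_eventually)
      then have "((\<lambda>t. u t x) \<longlongrightarrow>
          ennreal ((g x powr \<alpha> * f x powr (1 - \<alpha>) - f x) / \<alpha> + f x)) (at_right 0)"
        unfolding u_def by (rule tendsto_ennrealI)
      also have "(g x powr \<alpha> * f x powr (1 - \<alpha>) - f x) / \<alpha> + f x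
          = 1 / \<alpha> * (g x powr \<alpha> / f x powr (\<alpha> - 1)) + (1 - 1 / \<alpha>) * f x"
        using powr_minus_divide[of "f x" "\<alpha> - 1"] assms(1) by (simp add: field_simps)
      also have "ennreal \<dots> = ennreal (1 / \<alpha>) * w x + ennreal (1 - 1 / \<alpha>) * ennreal (f x)"
        unfolding w_def using assms(1) pos
        by (simp add: divide_ennreal flip: ennreal_mult ennreal_plus)
      finally show ?thesis .
    next
      \<comment> \<open>Where f vanishes and g does not, the quotient diverges, in agreement with
        \<open>w x = top\<close>; where both vanish, all terms are 0.\<close>
      case True
      show ?thesis
      proof (cases "g x = 0")
        case True
        with \<open>f x = 0\<close> show ?thesis
          by (simp add: u_def w_def power_mean_def)
      next
        case False
        then have "0 < g x" using nonneg(2)[of x] by simp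
        from power_mean_derivative_at_zero[OF assms(1) this]
        have "((\<lambda>t. u t x) \<longlongrightarrow> top) (at_right 0)"
          unfolding u_def using \<open>f x = 0\<close> by (simp add: ennreal_tendsto_top_eq_at_top)
        moreover have "w x = top"
          unfolding w_def using \<open>f x = 0\<close> \<open>0 < g x\<close> by simp
        ultimately show ?thesis
          using assms(1) by (simp add: ennreal_mult_top)
      qed
    qed
  next
    fix t :: real
    assume t: "0 < t" "t < 1"
    have ge: "(1 - t) * f x \<le> power_mean \<alpha> t (f x) (g x)" for x
      using power_mean_ge[of \<alpha> t "f x" "g x"] t nonneg[of x] assms(1)
      by (smt (verit) mult_nonneg_nonneg)
    have "ennreal t * (\<integral>\<^sup>+x. u t x \<partial>M) + ennreal (1 - t)
        = (\<integral>\<^sup>+x. ennreal t * u t x + ennreal (1 - t) * ennreal (f x) \<partial>M)"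
      using f1 by (simp add: nn_integral_add nn_integral_cmult)
    also have "\<dots> = (\<integral>\<^sup>+x. power_mean \<alpha> t (f x) (g x) \<partial>M)"
      unfolding u_def using t ge nonneg
      by (intro nn_integral_cong) (simp flip: ennreal_mult ennreal_plus)
    also have "\<dots> \<le> ennreal (1 + t * ((c - 1) / \<alpha>))"
      using t by (rule bound)
    finally have *: "ennreal t * (\<integral>\<^sup>+x. u t x \<partial>M) + ennreal (1 - t) \<le> ennreal (1 + t * ((c - 1) / \<alpha>))" .
    show "(\<integral>\<^sup>+x. u t x \<partial>M) \<le> ennreal (1 + (c - 1) / \<alpha>)"
    proof (cases "\<integral>\<^sup>+x. u t x \<partial>M")
      case (real i)
      then have "t * i + (1 - t) \<le> 1 + t * ((c - 1) / \<alpha>)"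
        using * t by (simp add: ennreal_le_iff2 flip: ennreal_mult ennreal_plus)
           (smt (verit) mult_nonneg_nonneg)
      then have "t * i \<le> t * (1 + (c - 1) / \<alpha>)"
        by (simp add: algebra_simps)
      then show ?thesis
        using t real by (simp add: ennreal_leI)
    qed (use * t in \<open>simp add: ennreal_mult_top top_unique\<close>)
  qed
  then have *: "ennreal (1 / \<alpha>) * (\<integral>\<^sup>+x. w x \<partial>M) + ennreal (1 - 1 / \<alpha>) \<le> ennreal (1 + (c - 1) / \<alpha>)"
    using f1 by (simp add: nn_integral_add nn_integral_cmult)
  have "(\<integral>\<^sup>+x. w x \<partial>M) \<le> ennreal c"
  proof (cases "\<integral>\<^sup>+x. w x \<partial>M")
    case (real i)
    \<comment> \<open>Since \<open>ennreal\<close> sends negative numbers to 0, an inequality of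
      reals is recovered only because the left-hand side is positive.\<close>
    have pos: "0 \<le> 1 / \<alpha> * i" "0 < 1 - 1 / \<alpha>"
      using assms(1) real by (auto simp: field_simps)
    from real * have "ennreal (1 / \<alpha> * i + (1 - 1 / \<alpha>)) \<le> ennreal (1 + (c - 1) / \<alpha>)"
      using assms(1) by (simp flip: ennreal_mult ennreal_plus)
    then have "1 / \<alpha> * i + (1 - 1 / \<alpha>) \<le> 1 + (c - 1) / \<alpha>"
      using pos by (smt (verit) ennreal_le_iff2)
    then show ?thesis
      using assms(1) real by (simp add: field_simps ennreal_leI)
  qed (use * assms(1) in \<open>simp add: ennreal_mult_top top_unique\<close>)
  then show ?thesis by (simp add: w_def)
qed

text \<open>The mean now lies below the chord, so Fatou's lemma is applied to (chord - mean) / t.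
  The limit is (\<alpha> g + (1 - \<alpha>) f - w) / \<alpha> with w the integrand of the claim; as
  f and g have mass one, an upper bound on its integral is a lower bound on that of w.\<close>

lemma nn_integral_ge_of_power_mean_ge:
  fixes f g :: "'a \<Rightarrow> real"
  assumes "0 < \<alpha>" "\<alpha> < 1"
    and [measurable]: "f \<in> borel_measurable M" "g \<in> borel_measurable M"
    and nonneg: "\<And>x. 0 \<le> f x" "\<And>x. 0 \<le> g x"
    and f1: "(\<integral>\<^sup>+x. f x \<partial>M) = 1" and g1: "(\<integral>\<^sup>+x. g x \<partial>M) = 1"
    and "0 \<le> c"
    and bound: "\<And>t. 0 < t \<Longrightarrow> t < 1 \<Longrightarrow>
      ennreal (1 + t * ((c - 1) / \<alpha>)) \<le> (\<integral>\<^sup>+x. power_mean \<alpha> t (f x) (g x) \<partial>M)"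
  shows "ennreal c \<le> (\<integral>\<^sup>+x. ennreal (g x powr \<alpha> * f x powr (1 - \<alpha>)) \<partial>M)"
proof -
  define u where "u = (\<lambda>t x. ennreal (((1 - t) * f x + t * g x - power_mean \<alpha> t (f x) (g x)) / t))"
  define w where "w = (\<lambda>x. g x powr \<alpha> * f x powr (1 - \<alpha>))"
  have [measurable]: "w \<in> borel_measurable M" "\<And>t. u t \<in> borel_measurable M"
    unfolding w_def u_def by measurable
  \<comment> \<open>Young's inequality makes the limit of the quotients nonnegative, so
    \<open>ennreal\<close> does not truncate it.\<close>
  have w_le: "w x \<le> \<alpha> * g x + (1 - \<alpha>) * f x" for x
  proof (cases "f x = 0 \<or> g x = 0")
    case False
    then show ?thesis
      using Youngs_inequality_0[of \<alpha> "1 - \<alpha>" "g x" "f x"] assms(1,2) nonneg[of x]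
      by (simp add: w_def)
  qed (use assms(1,2) nonneg in \<open>auto simp: w_def\<close>)
  have key: "\<exists>i\<ge>0. (\<integral>\<^sup>+x. u t x \<partial>M) = ennreal i \<and> i \<le> (1 - c) / \<alpha>"
    if t: "0 < t" "t < 1" for t
  proof -
    have le: "power_mean \<alpha> t (f x) (g x) \<le> (1 - t) * f x + t * g x" for x
      using power_mean_le[of \<alpha> t "f x" "g x"] t nonneg[of x] assms(1,2) by simp
    have "ennreal t * (\<integral>\<^sup>+x. u t x \<partial>M) + ennreal (1 + t * ((c - 1) / \<alpha>))
        \<le> ennreal t * (\<integral>\<^sup>+x. u t x \<partial>M) + (\<integral>\<^sup>+x. power_mean \<alpha> t (f x) (g x) \<partial>M)"
      using t by (intro add_mono bound) auto
    also have "\<dots> = (\<integral>\<^sup>+x. ennreal t * u t x + ennreal (power_mean \<alpha> t (f x) (g x)) \<partial>M)"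
      by (simp add: nn_integral_add nn_integral_cmult)
    also have "\<dots> = (\<integral>\<^sup>+x. ennreal (1 - t) * ennreal (f x) + ennreal t * ennreal (g x) \<partial>M)"
      unfolding u_def using t le nonneg
      by (intro nn_integral_cong) (simp flip: ennreal_mult ennreal_plus)
    also have "\<dots> = 1"
      using f1 g1 t by (simp add: nn_integral_add nn_integral_cmult flip: ennreal_plus)
    finally have *: "ennreal t * (\<integral>\<^sup>+x. u t x \<partial>M) + ennreal (1 + t * ((c - 1) / \<alpha>)) \<le> ennreal 1"
      by simp
    show ?thesis
    proof (cases "\<integral>\<^sup>+x. u t x \<partial>M")
      case (real i)
      have "t * i + (1 + t * ((c - 1) / \<alpha>)) \<le> 1"
      \<comment> \<open>A negative linear bound is truncated to 0 by \<open>ennreal\<close>; then t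
        * i \<le> 1 already implies the claim.\<close>
      proof (cases "0 \<le> 1 + t * ((c - 1) / \<alpha>)")
        case True
        with * real t show ?thesis
          by (simp add: ennreal_le_iff2 flip: ennreal_mult ennreal_plus)
      next
        case False
        with * real t show ?thesis
          by (simp add: ennreal_neg flip: ennreal_mult)
      qed
      then have "t * i \<le> t * ((1 - c) / \<alpha>)"
        by (simp add: algebra_simps diff_divide_distrib)
      then have "i \<le> (1 - c) / \<alpha>"
        using t by (simp only: mult_le_cancel_left_pos)
      then show ?thesis
        using real by auto
    qed (use * t in \<open>simp add: ennreal_mult_top top_unique\<close>)
  qed
  \<comment> \<open>A nonnegative integral lies below this number, so a single t in (0, 1) already
    forces c \<le> 1 and \<open>ennreal (1 - c)\<close> is not truncated.\<close>
  have "0 \<le> (1 - c) / \<alpha>"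
    using key[of "1 / 2"] by force
  then have "c \<le> 1"
    using assms(1) by (simp add: zero_le_divide_iff)
  have "(\<integral>\<^sup>+x. ennreal (((\<alpha> * g x + (1 - \<alpha>) * f x) - w x) / \<alpha>) \<partial>M) \<le> ennreal ((1 - c) / \<alpha>)"
  proof (rule nn_integral_le_at_right)
    show "u t \<in> borel_measurable M" for t by measurable
  next
    fix x
    have "((\<lambda>t. ((1 - t) * f x + t * g x - power_mean \<alpha> t (f x) (g x)) / t) \<longlongrightarrow>
        ((\<alpha> * g x + (1 - \<alpha>) * f x) - w x) / \<alpha>) (at_right 0)"
    proof (cases "f x = 0")
      case False
      then have "0 < f x" using nonneg(1)[of x] by simp
      then have "((\<lambda>t. g x - f x - (power_mean \<alpha> t (f x) (g x) - f x) / t) \<longlongrightarrow>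
          g x - f x - (w x - f x) / \<alpha>) (at_right 0)"
        unfolding w_def using assms(1) by (intro tendsto_intros power_mean_derivative)
      moreover have "\<forall>\<^sub>F t in at_right (0::real). g x - f x - (power_mean \<alpha> t (f x) (g x) - f x) / t
          = ((1 - t) * f x + t * g x - power_mean \<alpha> t (f x) (g x)) / t"
        using eventually_at_right_less[of 0] by eventually_elim (simp add: field_simps)
      ultimately have "((\<lambda>t. ((1 - t) * f x + t * g x - power_mean \<alpha> t (f x) (g x)) / t) \<longlongrightarrow>
          g x - f x - (w x - f x) / \<alpha>) (at_right 0)"
        by (rule Lim_transform_eventually)
      moreover have "g x - f x - (w x - f x) / \<alpha> = ((\<alpha> * g x + (1 - \<alpha>) * f x) - w x) / \<alpha>"
        using assms(1) by (simp add: field_simps)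
      ultimately show ?thesis by simp
    next
      case True
      \<comment> \<open>For f x = 0 the quotient is g x * (1 - t powr (1 / \<alpha> - 1)). The
        exponent is positive, so the limit is g x.\<close>
      have "((\<lambda>t::real. t powr (1 / \<alpha> - 1)) \<longlongrightarrow> 0) (at_right 0)"
        using assms(1,2) by real_asymp
      then have "((\<lambda>t. g x - g x * t powr (1 / \<alpha> - 1)) \<longlongrightarrow> g x - g x * 0) (at_right 0)"
        by (intro tendsto_intros)
      moreover have "\<forall>\<^sub>F t in at_right (0::real). g x - g x * t powr (1 / \<alpha> - 1)
          = ((1 - t) * f x + t * g x - power_mean \<alpha> t (f x) (g x)) / t"
        using eventually_at_right_less[of 0]
      proof eventually_elim
        case (elim t)
        then have "power_mean \<alpha> t 0 (g x) = g x * (t powr (1 / \<alpha> - 1) * t)"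
          using assms(1) nonneg(2)[of x]
          by (simp add: power_mean_def powr_mult powr_powr powr_diff)
        with True elim show ?case by (simp add: field_simps)
      qed
      ultimately show ?thesis
        using True assms(1) by (simp add: w_def Lim_transform_eventually)
    qed
    then show "((\<lambda>t. u t x) \<longlongrightarrow> ennreal (((\<alpha> * g x + (1 - \<alpha>) * f x) - w x) / \<alpha>)) (at_right 0)"
      unfolding u_def by (rule tendsto_ennrealI)
  next
    show "(\<integral>\<^sup>+x. u t x \<partial>M) \<le> ennreal ((1 - c) / \<alpha>)" if "0 < t" "t < 1" for t
      using key[OF that] by (auto intro: ennreal_leI)
  qed
  also have "ennreal ((1 - c) / \<alpha>) = ennreal (1 / \<alpha>) * ennreal (1 - c)"
    using assms(1) by (simp flip: ennreal_mult')
  finally have "ennreal \<alpha> * (\<integral>\<^sup>+x. ennreal (((\<alpha> * g x + (1 - \<alpha>) * f x) - w x) / \<alpha>) \<partial>M)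
      \<le> ennreal \<alpha> * (ennreal (1 / \<alpha>) * ennreal (1 - c))"
    by (intro mult_left_mono) auto
  also have "\<dots> = ennreal (1 - c)"
    using assms(1) by (simp add: mult.assoc[symmetric] flip: ennreal_mult)
  finally have *: "ennreal \<alpha> * (\<integral>\<^sup>+x. ennreal (((\<alpha> * g x + (1 - \<alpha>) * f x) - w x) / \<alpha>) \<partial>M)
      \<le> ennreal (1 - c)" .
  have "1 = (\<integral>\<^sup>+x. ennreal \<alpha> * ennreal (g x) + ennreal (1 - \<alpha>) * ennreal (f x) \<partial>M)"
    using f1 g1 assms(1,2) by (simp add: nn_integral_add nn_integral_cmult flip: ennreal_plus)
  also have "\<dots> = (\<integral>\<^sup>+x. ennreal \<alpha> * ennreal (((\<alpha> * g x + (1 - \<alpha>) * f x) - w x) / \<alpha>) + ennreal (w x) \<partial>M)"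
    using assms(1,2) w_le nonneg
    by (intro nn_integral_cong) (simp add: w_def flip: ennreal_mult ennreal_plus)
  also have "\<dots> \<le> ennreal (1 - c) + (\<integral>\<^sup>+x. w x \<partial>M)"
    using * by (simp add: nn_integral_add nn_integral_cmult add_right_mono)
  finally have "ennreal c \<le> (\<integral>\<^sup>+x. w x \<partial>M)"
    using \<open>c \<le> 1\<close>
    by (cases "\<integral>\<^sup>+x. w x \<partial>M") (auto simp: ennreal_le_iff2 simp flip: ennreal_plus ennreal_1)
  then show ?thesis by (simp add: w_def)
qed

section \<open>The integrand of the Kullback-Leibler divergence\<close>

text \<open>The summand \<open>q - p\<close> integrates to \<open>0\<close> for probability densities and makes the integrand
  nonnegative. For \<open>p = 0\<close> the real formula has the value \<open>q\<close>, because \<open>0 * ln 0 = 0\<close>.\<close>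

definition kl_integrand :: "real \<Rightarrow> real \<Rightarrow> ennreal" where
  "kl_integrand p q = (if p \<noteq> 0 \<and> q = 0 then top else ennreal (p * ln (p / q) - p + q))"

lemma borel_measurable_kl_integrand [measurable]:
  assumes [measurable]: "f \<in> borel_measurable M" "g \<in> borel_measurable M"
  shows "(\<lambda>x. kl_integrand (f x) (g x)) \<in> borel_measurable M"
  unfolding kl_integrand_def by measurable

text \<open>This is ln u \<le> u - 1 at u = q / p, multiplied by p.\<close>

lemma kl_real_nonneg:
  fixes p q :: real
  assumes "0 \<le> p" "0 < q"
  shows "0 \<le> p * ln (p / q) - p + q"
proof (cases "p = 0")
  case False
  then have "p * ln (q / p) \<le> p * (q / p - 1)"
    using assms by (intro mult_left_mono ln_le_minus_one) auto
  then show ?thesis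
    using False assms by (simp add: ln_div algebra_simps)
qed (use assms in simp)

lemma kl_real_split:
  fixes p q m :: real
  assumes "0 \<le> p" "0 < m" "0 < q"
  shows "p * ln (p / q) = p * ln (p / m) + p * ln (m / q)"
  using assms by (cases "p = 0") (auto simp: ln_div algebra_simps)

text \<open>With m the mixture, the right-hand side equals the left-hand side plus (1 - t) times the
  integrand of r relative to m, and this nonnegative term is dropped. If q = 0 and m > 0, the
  right-hand side is infinite since both weights are positive.\<close>

lemma kl_integrand_compensation:
  assumes "0 \<le> p" "0 \<le> r" "0 \<le> q" "0 < t" "t < 1"
  shows "kl_integrand ((1 - t) * r + t * p) q + ennreal t * kl_integrand p ((1 - t) * r + t * p)
    \<le> ennreal (1 - t) * kl_integrand r q + ennreal t * kl_integrand p q"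
proof (cases "r = 0 \<and> p = 0")
  case True
  then show ?thesis
    using assms by (simp add: kl_integrand_def flip: ennreal_mult ennreal_plus distrib_right)
next
  case nonzero: False
  show ?thesis
  proof (cases "q = 0")
    case True
    then show ?thesis
      using nonzero assms by (auto simp: kl_integrand_def)
  next
    case False
    define m where "m = (1 - t) * r + t * p"
    have "0 < m" "0 < q"
      unfolding m_def using nonzero assms False
      by (auto simp: less_le add_nonneg_eq_0_iff)
    have nonneg: "0 \<le> r * ln (r / m) - r + m" "0 \<le> p * ln (p / m) - p + m"
      "0 \<le> r * ln (r / q) - r + q" "0 \<le> p * ln (p / q) - p + q" "0 \<le> m * ln (m / q) - m + q"
      using assms \<open>0 < m\<close> \<open>0 < q\<close> by (auto intro!: kl_real_nonneg)
    have "(1 - t) * (r * ln (r / q) - r + q) + t * (p * ln (p / q) - p + q)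
        = (m * ln (m / q) - m + q) + (1 - t) * (r * ln (r / m) - r + m) + t * (p * ln (p / m) - p + m)"
      using assms \<open>0 < m\<close> \<open>0 < q\<close>
      by (simp add: kl_real_split[of r m q] kl_real_split[of p m q]) (simp add: m_def algebra_simps)
    moreover have "0 \<le> (1 - t) * (r * ln (r / m) - r + m)"
      using nonneg assms by simp
    ultimately have "(m * ln (m / q) - m + q) + t * (p * ln (p / m) - p + m)
        \<le> (1 - t) * (r * ln (r / q) - r + q) + t * (p * ln (p / q) - p + q)"
      by simp
    then show ?thesis
      unfolding m_def[symmetric] using \<open>0 < m\<close> \<open>0 < q\<close> nonneg assms
      by (simp add: kl_integrand_def ennreal_leI flip: ennreal_mult ennreal_plus)
  qed
qed

lemma kl_integrand_tendsto:
  assumes "0 \<le> p" "0 \<le> r"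
  shows "((\<lambda>t. kl_integrand p ((1 - t) * r + t * p)) \<longlongrightarrow> kl_integrand p r) (at_right 0)"
proof -
  consider "p = 0" | "0 < p" "0 < r" | "0 < p" "r = 0"
    using assms by linarith
  then show ?thesis
  proof cases
    case 1
    have "((\<lambda>t. ennreal ((1 - t) * r)) \<longlongrightarrow> ennreal ((1 - 0) * r)) (at_right 0)"
      by (intro tendsto_intros)
    with 1 show ?thesis by (simp add: kl_integrand_def)
  next
    case 2
    define m where "m = (\<lambda>t. (1 - t) * r + t * p)"
    have "(m \<longlongrightarrow> (1 - 0) * r + 0 * p) (at_right 0)"
      unfolding m_def by (intro tendsto_intros)
    then have m: "(m \<longlongrightarrow> r) (at_right 0)" by simp
    have "\<forall>\<^sub>F t in at_right 0. 0 < m t"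
      using order_tendstoD(1)[OF m] 2 by simp
    then have "\<forall>\<^sub>F t in at_right 0. ennreal (p * ln (p / m t) - p + m t) = kl_integrand p (m t)"
      by eventually_elim (simp add: kl_integrand_def)
    moreover have "((\<lambda>t. ennreal (p * ln (p / m t) - p + m t)) \<longlongrightarrow> ennreal (p * ln (p / r) - p + r)) (at_right 0)"
      using 2 by (intro tendsto_intros m) auto
    ultimately show ?thesis
      using 2 by (simp add: kl_integrand_def m_def Lim_transform_eventually)
  next
    case 3
    \<comment> \<open>For r = 0 the second argument is t * p, so the ratio is 1 / t and the
      logarithm diverges.\<close>
    have "filterlim (\<lambda>t. p * ln (1 / t) - p + t * p) at_top (at_right (0::real))"
      using 3 by real_asymp
    then have "((\<lambda>t. ennreal (p * ln (1 / t) - p + t * p)) \<longlongrightarrow> top) (at_right 0)"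
      by (simp add: ennreal_tendsto_top_eq_at_top)
    moreover have "\<forall>\<^sub>F t in at_right 0. ennreal (p * ln (1 / t) - p + t * p) = kl_integrand p (t * p)"
      using eventually_at_right_less[of 0]
      by eventually_elim (use 3 in \<open>simp add: kl_integrand_def\<close>)
    ultimately show ?thesis
      using 3 by (simp add: kl_integrand_def Lim_transform_eventually)
  qed
qed

text \<open>Up to the factor \<open>s\<close>, the gap in Young's inequality integrates to one minus the Renyi integral
  of order \<open>1 - s\<close>. It increases to \<^const>\<open>kl_integrand\<close> as \<open>s\<close> decreases to \<open>0\<close>.\<close>

definition young_gap :: "real \<Rightarrow> real \<Rightarrow> real \<Rightarrow> real" where
  "young_gap s p q = ((1 - s) * p + s * q - p powr (1 - s) * q powr s) / s"

lemma young_gap_nonneg: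
  assumes "0 < s" "s < 1" "0 \<le> p" "0 \<le> q"
  shows "0 \<le> young_gap s p q"
proof (cases "p = 0 \<or> q = 0")
  case False
  then show ?thesis
    using Youngs_inequality_0[of "1 - s" s p q] assms by (simp add: young_gap_def)
qed (use assms in \<open>auto simp: young_gap_def\<close>)

text \<open>In this form s occurs only in a difference quotient of the exponential function at 0,
  from which both the limit and the upper bound are read off.\<close>

lemma young_gap_pos_eq:
  assumes "0 < p" "0 < q" "s \<noteq> 0"
  shows "young_gap s p q = p * ((1 - exp (s * ln (q / p))) / s) - p + q"
proof -
  have "p powr (1 - s) * q powr s = p * exp (s * ln (q / p))"
  proof -
    have "p powr (1 - s) = p / p powr s"
      using assms by (simp add: powr_diff)
    then show ?thesis
      using assms by (simp add: powr_def ln_div exp_diff right_diff_distrib)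
  qed
  then show ?thesis
    using assms(3) by (simp add: young_gap_def field_simps)
qed

text \<open>For positive arguments this is exp u \<ge> 1 + u at u = s * ln (q / p).\<close>

lemma young_gap_le_kl_integrand:
  assumes "0 < s" "s < 1" "0 \<le> p" "0 \<le> q"
  shows "ennreal (young_gap s p q) \<le> kl_integrand p q"
proof -
  consider "p = 0" | "0 < p" "q = 0" | "0 < p" "0 < q"
    using assms by linarith
  then show ?thesis
  proof cases
    case 3
    have "1 + s * ln (q / p) \<le> exp (s * ln (q / p))"
      by (rule exp_ge_add_one_self)
    then have "(1 - exp (s * ln (q / p))) / s \<le> - ln (q / p)"
      using assms by (simp add: field_simps)
    then have "p * ((1 - exp (s * ln (q / p))) / s) \<le> p * (- ln (q / p))"
      using 3 by (intro mult_left_mono) auto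
    then show ?thesis
      using 3 assms by (simp add: young_gap_pos_eq kl_integrand_def ln_div ennreal_leI)
  qed (use assms in \<open>auto simp: young_gap_def kl_integrand_def\<close>)
qed

lemma young_gap_tendsto:
  assumes "0 \<le> p" "0 \<le> q"
  shows "((\<lambda>s. ennreal (young_gap s p q)) \<longlongrightarrow> kl_integrand p q) (at_right 0)"
proof -
  consider "p = 0" | "0 < p" "q = 0" | "0 < p" "0 < q"
    using assms by linarith
  then show ?thesis
  proof cases
    case 1
    have "\<forall>\<^sub>F s in at_right (0::real). ennreal q = ennreal (young_gap s p q)"
      using eventually_at_right_less[of 0]
      by eventually_elim (use 1 in \<open>simp add: young_gap_def\<close>)
    then have "((\<lambda>s. ennreal (young_gap s p q)) \<longlongrightarrow> ennreal q) (at_right 0)"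
      by (rule Lim_transform_eventually[OF tendsto_const])
    then show ?thesis
      using 1 by (simp add: kl_integrand_def)
  next
    case 2
    have "filterlim (\<lambda>s. (1 - s) * p / s) at_top (at_right (0::real))"
      using 2 by real_asymp
    with 2 show ?thesis
      by (simp add: kl_integrand_def young_gap_def ennreal_tendsto_top_eq_at_top)
  next
    case 3
    have "((\<lambda>s. p * ((1 - exp (s * ln (q / p))) / s) - p + q) \<longlongrightarrow> p * (- ln (q / p)) - p + q) (at_right 0)"
      by real_asymp
    moreover have "\<forall>\<^sub>F s in at_right (0::real).
        p * ((1 - exp (s * ln (q / p))) / s) - p + q = young_gap s p q"
      using eventually_at_right_less[of 0]
      by eventually_elim (use 3 in \<open>simp add: young_gap_pos_eq\<close>)
    ultimately have "((\<lambda>s. young_gap s p q) \<longlongrightarrow> p * (- ln (q / p)) - p + q) (at_right 0)"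
      by (rule Lim_transform_eventually)
    then show ?thesis
      using 3 by (simp add: kl_integrand_def ln_div tendsto_ennrealI)
  qed
qed

text \<open>Fatou's lemma bounds the lower limit from below, and the pointwise domination by the
  limit function bounds the upper limit from above.\<close>

lemma young_gap_integral_tendsto:
  assumes [measurable]: "f \<in> borel_measurable M" "g \<in> borel_measurable M"
    and nonneg: "\<And>x. 0 \<le> f x" "\<And>x. 0 \<le> g x"
  shows "((\<lambda>s. \<integral>\<^sup>+x. young_gap s (f x) (g x) \<partial>M) \<longlongrightarrow> (\<integral>\<^sup>+x. kl_integrand (f x) (g x) \<partial>M)) (at_right 0)"
proof (rule tendsto_at_right_sequentially[of _ 1])
  have [measurable]: "(\<lambda>x. young_gap s (f x) (g x)) \<in> borel_measurable M" for s
    unfolding young_gap_def by measurable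
  fix s :: "nat \<Rightarrow> real"
  assume s: "\<And>n. 0 < s n" "\<And>n. s n < 1" "s \<longlonglongrightarrow> 0"
  have filter: "filterlim s (at_right 0) sequentially"
    using s by (simp add: filterlim_at less_imp_neq[symmetric])
  define I where "I = (\<lambda>n. \<integral>\<^sup>+x. young_gap (s n) (f x) (g x) \<partial>M)"
  define K where "K = (\<integral>\<^sup>+x. kl_integrand (f x) (g x) \<partial>M)"
  have "K \<le> liminf I"
    unfolding K_def I_def
    using filterlim_compose[OF young_gap_tendsto filter] nonneg
    by (intro nn_integral_le_liminf) auto
  moreover have "I n \<le> K" for n
    unfolding I_def K_def
    using s nonneg by (intro nn_integral_mono young_gap_le_kl_integrand) auto
  then have "limsup I \<le> limsup (\<lambda>_. K)"
    by (intro Limsup_mono) auto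
  then have "limsup I \<le> K" by (simp add: Limsup_const)
  moreover have "liminf I \<le> limsup I"
    by (intro Liminf_le_Limsup trivial_limit_sequentially)
  ultimately show "I \<longlonglongrightarrow> K"
    by (intro Liminf_eq_Limsup trivial_limit_sequentially) auto
qed simp

section \<open>Densities, mixtures and Renyi integrals\<close>

lemma borel_measurable_pdf [measurable]: "pdf \<mu> P \<in> borel_measurable \<mu>"
  unfolding pdf_def by measurable

lemma pdf_nonneg [simp]: "0 \<le> pdf \<mu> P x"
  by (simp add: pdf_def)

text \<open>P is finite, so its derivative is finite almost everywhere and \<open>enn2real\<close>
  preserves the integral, which is the total mass of P.\<close>

lemma nn_integral_pdf:
  assumes "sigma_finite_measure \<mu>" "P \<in> distributions \<mu>"
  shows "(\<integral>\<^sup>+x. pdf \<mu> P x \<partial>\<mu>) = 1"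
proof -
  interpret \<mu>: sigma_finite_measure \<mu> by fact
  have P: "prob_space P" "sets P = sets \<mu>" "absolutely_continuous \<mu> P"
    using assms(2) by (auto simp: distributions_def)
  interpret P: prob_space P by fact
  have "AE x in \<mu>. RN_deriv \<mu> P x \<noteq> \<infinity>"
    using P P.sigma_finite_measure_axioms by (intro \<mu>.RN_deriv_finite)
  then have "AE x in \<mu>. ennreal (pdf \<mu> P x) = RN_deriv \<mu> P x"
    by eventually_elim (simp add: pdf_def less_top)
  then have "(\<integral>\<^sup>+x. pdf \<mu> P x \<partial>\<mu>) = (\<integral>\<^sup>+x. RN_deriv \<mu> P x \<partial>\<mu>)"
    by (rule nn_integral_cong_AE)
  also have "\<dots> = emeasure (density \<mu> (RN_deriv \<mu> P)) (space \<mu>)"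
    by (simp add: emeasure_density cong: nn_integral_cong)
  also have "\<dots> = 1"
    using \<mu>.density_RN_deriv[OF P(3,2)] P.emeasure_space_1 sets_eq_imp_space_eq[OF P(2)] by simp
  finally show ?thesis .
qed

lemma pdf_density_AE:
  assumes "sigma_finite_measure \<mu>" and "f \<in> borel_measurable \<mu>" and nonneg: "\<And>x. 0 \<le> f x"
  shows "AE x in \<mu>. pdf \<mu> (density \<mu> (\<lambda>x. ennreal (f x))) x = f x"
proof -
  interpret \<mu>: sigma_finite_measure \<mu> by fact
  have "AE x in \<mu>. ennreal (f x) = RN_deriv \<mu> (density \<mu> (\<lambda>x. ennreal (f x))) x"
    using assms(2) by (intro \<mu>.RN_deriv_unique) auto
  then show ?thesis
    by eventually_elim (metis pdf_def enn2real_ennreal nonneg)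
qed

text \<open>The factor depending on Q alone; with it the Renyi integral is visibly linear in the
  \<alpha>-th power of the density of P. For \<alpha> > 1 the rules inverse 0 = \<infinity> and 0 *
  \<infinity> = 0 encode the conventions for quotients.\<close>

definition renyi_weight :: "'a measure \<Rightarrow> real \<Rightarrow> 'a measure \<Rightarrow> 'a \<Rightarrow> ennreal" where
  "renyi_weight \<mu> \<alpha> Q x = (if \<alpha> < 1 then ennreal (pdf \<mu> Q x powr (1 - \<alpha>))
    else inverse (ennreal (pdf \<mu> Q x powr (\<alpha> - 1))))"

lemma borel_measurable_renyi_weight [measurable]: "renyi_weight \<mu> \<alpha> Q \<in> borel_measurable \<mu>"
  unfolding renyi_weight_def by measurable

lemma renyi_integral_eq_weight:
  "renyi_integral \<mu> \<alpha> P Q = (\<integral>\<^sup>+x. ennreal (pdf \<mu> P x powr \<alpha>) * renyi_weight \<mu> \<alpha> Q x \<partial>\<mu>)"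
  by (simp add: renyi_integral_def renyi_weight_def ennreal_mult divide_ennreal_def)

lemma mixture_numerator_eq:
  "mixture_numerator \<mu> \<alpha> (1 - t) t R P x = power_mean \<alpha> t (pdf \<mu> R x) (pdf \<mu> P x)"
  by (simp add: mixture_numerator_def power_mean_def)

text \<open>The normalising constant is finite because the mean is at most the sum of the densities.
  It is nonzero because a mean vanishing almost everywhere would make the density of R vanish
  too.\<close>

lemma alpha_mixture_pdf:
  assumes "sigma_finite_measure \<mu>" "P \<in> distributions \<mu>" "R \<in> distributions \<mu>"
    and "0 < \<alpha>" "0 < t" "t < 1"
  obtains z where "0 < z" "(\<integral>\<^sup>+x. power_mean \<alpha> t (pdf \<mu> R x) (pdf \<mu> P x) \<partial>\<mu>) = ennreal z"
    and "AE x in \<mu>. pdf \<mu> (alpha_mixture \<mu> \<alpha> (1 - t) t R P) x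
      = power_mean \<alpha> t (pdf \<mu> R x) (pdf \<mu> P x) / z"
proof -
  define s where "s = (\<lambda>x. power_mean \<alpha> t (pdf \<mu> R x) (pdf \<mu> P x))"
  have s [measurable]: "s \<in> borel_measurable \<mu>" unfolding s_def by measurable
  have s0: "0 \<le> s x" for x by (simp add: s_def)
  have "(\<integral>\<^sup>+x. s x \<partial>\<mu>) \<le> (\<integral>\<^sup>+x. ennreal (pdf \<mu> R x) + ennreal (pdf \<mu> P x) \<partial>\<mu>)"
    using assms by (intro nn_integral_mono)
      (simp add: s_def ennreal_leI power_mean_le_add flip: ennreal_plus)
  also have "\<dots> = 1 + 1"
    using assms by (simp add: nn_integral_add nn_integral_pdf)
  also have "\<dots> < top" by simp
  finally have "(\<integral>\<^sup>+x. s x \<partial>\<mu>) \<noteq> top" by simp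
  moreover have "(\<integral>\<^sup>+x. s x \<partial>\<mu>) \<noteq> 0"
  proof
    assume "(\<integral>\<^sup>+x. s x \<partial>\<mu>) = 0"
    then have "AE x in \<mu>. s x \<le> 0"
      by (simp add: nn_integral_0_iff_AE ennreal_eq_0_iff)
    then have "AE x in \<mu>. ennreal (pdf \<mu> R x) = 0"
    proof eventually_elim
      case (elim x)
      then have "(1 - t) * pdf \<mu> R x powr \<alpha> + t * pdf \<mu> P x powr \<alpha> = 0"
        using s0[of x] by (simp add: s_def power_mean_def)
      with assms(5,6) show ?case
        by (simp add: add_nonneg_eq_0_iff)
    qed
    then have "(\<integral>\<^sup>+x. pdf \<mu> R x \<partial>\<mu>) = 0"
      by (subst nn_integral_0_iff_AE) auto
    with assms show False by (simp add: nn_integral_pdf)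
  qed
  ultimately obtain z where z: "0 < z" "(\<integral>\<^sup>+x. s x \<partial>\<mu>) = ennreal z"
    by (cases "\<integral>\<^sup>+x. s x \<partial>\<mu>") (auto simp: less_le)
  have "alpha_mixture \<mu> \<alpha> (1 - t) t R P = density \<mu> (\<lambda>x. ennreal (s x / z))"
    using z s0 by (simp add: alpha_mixture_def mixture_numerator_eq divide_ennreal s_def)
  moreover have "AE x in \<mu>. pdf \<mu> (density \<mu> (\<lambda>x. ennreal (s x / z))) x = s x / z"
    using z s0 assms(1) by (intro pdf_density_AE) auto
  ultimately show ?thesis
    using that[of z] z by (simp add: s_def)
qed

text \<open>The \<alpha>-th power of the mean is affine in the \<alpha>-th powers of the two
  densities. Keeping z powr \<alpha> as a factor lets the identity cover infinite integrals.\<close>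

lemma renyi_integral_mixture:
  assumes "0 < \<alpha>" "0 < t" "t < 1" "0 < z"
    and AE: "AE x in \<mu>. pdf \<mu> (alpha_mixture \<mu> \<alpha> (1 - t) t R P) x
      = power_mean \<alpha> t (pdf \<mu> R x) (pdf \<mu> P x) / z"
  shows "ennreal (z powr \<alpha>) * renyi_integral \<mu> \<alpha> (alpha_mixture \<mu> \<alpha> (1 - t) t R P) Q
    = ennreal (1 - t) * renyi_integral \<mu> \<alpha> R Q + ennreal t * renyi_integral \<mu> \<alpha> P Q"
proof -
  let ?m = "alpha_mixture \<mu> \<alpha> (1 - t) t R P"
  have "ennreal (z powr \<alpha>) * renyi_integral \<mu> \<alpha> ?m Q
      = (\<integral>\<^sup>+x. ennreal (z powr \<alpha>) * (ennreal (pdf \<mu> ?m x powr \<alpha>) * renyi_weight \<mu> \<alpha> Q x) \<partial>\<mu>)"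
    unfolding renyi_integral_eq_weight by (simp add: nn_integral_cmult)
  also have "\<dots> = (\<integral>\<^sup>+x. ennreal (1 - t) * (ennreal (pdf \<mu> R x powr \<alpha>) * renyi_weight \<mu> \<alpha> Q x)
      + ennreal t * (ennreal (pdf \<mu> P x powr \<alpha>) * renyi_weight \<mu> \<alpha> Q x) \<partial>\<mu>)"
  proof (rule nn_integral_cong_AE, use AE in eventually_elim)
    case (elim x)
    have "z powr \<alpha> * pdf \<mu> ?m x powr \<alpha> = power_mean \<alpha> t (pdf \<mu> R x) (pdf \<mu> P x) powr \<alpha>"
      unfolding elim using assms(4) by (simp add: powr_divide)
    also have "\<dots> = (1 - t) * pdf \<mu> R x powr \<alpha> + t * pdf \<mu> P x powr \<alpha>"
      using assms by (simp add: power_mean_powr)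
    finally have "ennreal (z powr \<alpha>) * ennreal (pdf \<mu> ?m x powr \<alpha>)
        = ennreal (1 - t) * ennreal (pdf \<mu> R x powr \<alpha>) + ennreal t * ennreal (pdf \<mu> P x powr \<alpha>)"
      using assms by (simp flip: ennreal_mult ennreal_plus)
    then show ?case
      by (simp only: distrib_right flip: mult.assoc)
  qed
  also have "\<dots> = ennreal (1 - t) * renyi_integral \<mu> \<alpha> R Q + ennreal t * renyi_integral \<mu> \<alpha> P Q"
    unfolding renyi_integral_eq_weight by (simp add: nn_integral_add nn_integral_cmult)
  finally show ?thesis .
qed

text \<open>The denominator is finite, so the quotient vanishes only where the density of P
  does.\<close>

lemma renyi_integral_pos:
  assumes "sigma_finite_measure \<mu>" "P \<in> distributions \<mu>" "1 < \<alpha>"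
  shows "0 < renyi_integral \<mu> \<alpha> P Q"
proof (rule ccontr)
  assume "\<not> 0 < renyi_integral \<mu> \<alpha> P Q"
  then have "AE x in \<mu>. ennreal (pdf \<mu> P x powr \<alpha>) / ennreal (pdf \<mu> Q x powr (\<alpha> - 1)) = 0"
    using assms(3) by (simp add: renyi_integral_def nn_integral_0_iff_AE)
  then have "AE x in \<mu>. ennreal (pdf \<mu> P x) = 0"
    by eventually_elim simp
  then have "(\<integral>\<^sup>+x. pdf \<mu> P x \<partial>\<mu>) = 0"
    by (subst nn_integral_0_iff_AE) auto
  with assms show False by (simp add: nn_integral_pdf)
qed

section \<open>Orders tending to 1 and the Kullback-Leibler divergence\<close>

lemma young_gap_renyi_integral:
  assumes "sigma_finite_measure \<mu>" "P \<in> distributions \<mu>" "Q \<in> distributions \<mu>"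
    and "0 < s" "s < 1"
  shows "ennreal s * (\<integral>\<^sup>+x. young_gap s (pdf \<mu> P x) (pdf \<mu> Q x) \<partial>\<mu>)
    + renyi_integral \<mu> (1 - s) P Q = 1"
proof -
  have [measurable]: "(\<lambda>x. young_gap s (pdf \<mu> P x) (pdf \<mu> Q x)) \<in> borel_measurable \<mu>"
    unfolding young_gap_def by measurable
  have "ennreal s * (\<integral>\<^sup>+x. young_gap s (pdf \<mu> P x) (pdf \<mu> Q x) \<partial>\<mu>)
    + renyi_integral \<mu> (1 - s) P Q
    = (\<integral>\<^sup>+x. ennreal s * ennreal (young_gap s (pdf \<mu> P x) (pdf \<mu> Q x))
        + ennreal (pdf \<mu> P x powr (1 - s) * pdf \<mu> Q x powr s) \<partial>\<mu>)"
    using assms(4) by (simp add: renyi_integral_def nn_integral_add nn_integral_cmult)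
  also have "\<dots> = (\<integral>\<^sup>+x. ennreal (1 - s) * ennreal (pdf \<mu> P x) + ennreal s * ennreal (pdf \<mu> Q x) \<partial>\<mu>)"
  proof (rule nn_integral_cong)
    fix x
    have "s * young_gap s (pdf \<mu> P x) (pdf \<mu> Q x) + pdf \<mu> P x powr (1 - s) * pdf \<mu> Q x powr s
        = (1 - s) * pdf \<mu> P x + s * pdf \<mu> Q x"
      using assms(4) by (simp add: young_gap_def)
    then show "ennreal s * ennreal (young_gap s (pdf \<mu> P x) (pdf \<mu> Q x))
        + ennreal (pdf \<mu> P x powr (1 - s) * pdf \<mu> Q x powr s)
        = ennreal (1 - s) * ennreal (pdf \<mu> P x) + ennreal s * ennreal (pdf \<mu> Q x)"
      using assms(4,5) young_gap_nonneg[of s "pdf \<mu> P x" "pdf \<mu> Q x"]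
      by (simp flip: ennreal_mult ennreal_plus)
  qed
  also have "\<dots> = 1"
    using assms by (simp add: nn_integral_add nn_integral_cmult nn_integral_pdf flip: ennreal_plus)
  finally show ?thesis .
qed

text \<open>The Renyi integral is 1 - s * h, so ln u \<le> u - 1 at u = 1 - s * h gives the lower
  bound, and at u = 1 / (1 - s * k) the upper one. Both become exact as s tends to 0.\<close>

lemma renyi_simple_bounds:
  assumes "0 < s" "s < 1" "0 \<le> h"
    and F: "ennreal s * ennreal h + renyi_integral \<mu> (1 - s) P Q = 1"
  shows "ereal h \<le> renyi_simple \<mu> (1 - s) P Q"
    and "h \<le> k \<Longrightarrow> s * k < 1 \<Longrightarrow> renyi_simple \<mu> (1 - s) P Q \<le> ereal (k / (1 - s * k))"
proof -
  obtain F where F': "0 \<le> F" "renyi_integral \<mu> (1 - s) P Q = ennreal F"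
    using F by (cases "renyi_integral \<mu> (1 - s) P Q") auto
  with F assms have "ennreal (s * h + F) = ennreal 1"
    by (simp flip: ennreal_mult ennreal_plus)
  with assms F' have F_eq: "F = 1 - s * h"
    by (subst (asm) ennreal_inj) auto
  \<comment> \<open>The prefactor for order 1 - s is - 1 / s, so an integral equal to 0 gives
    divergence \<infinity>.\<close>
  have D: "renyi_simple \<mu> (1 - s) P Q = (if F = 0 then \<infinity> else ereal (- ln F / s))"
    using assms F' by (simp add: renyi_simple_def ext_ln_def)
  show "ereal h \<le> renyi_simple \<mu> (1 - s) P Q"
  proof (cases "F = 0")
    case False
    then have "ln F \<le> F - 1"
      using F' by (intro ln_le_minus_one) simp
    then have "s * h \<le> - ln F"
      unfolding F_eq by simp
    then have "h \<le> - ln F / s"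
      using assms(1) by (subst pos_le_divide_eq) (simp_all add: mult.commute)
    with False show ?thesis by (simp add: D)
  qed (simp add: D)
  show "renyi_simple \<mu> (1 - s) P Q \<le> ereal (k / (1 - s * k))" if k: "h \<le> k" "s * k < 1"
  proof -
    have "s * h \<le> s * k"
      using k assms(1) by simp
    then have "1 - s * k \<le> F" "0 < 1 - s * k"
      using k F_eq by auto
    then have "- ln F \<le> ln (1 / (1 - s * k))"
      by (simp add: ln_div)
    also have "\<dots> \<le> 1 / (1 - s * k) - 1"
      using \<open>0 < 1 - s * k\<close> by (intro ln_le_minus_one) simp
    also have "\<dots> = s * (k / (1 - s * k))"
      using \<open>0 < 1 - s * k\<close> by (simp add: field_simps)
    finally have "- ln F / s \<le> k / (1 - s * k)"
      using assms(1) by (subst pos_divide_le_eq) (simp_all add: mult.commute)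
    with \<open>1 - s * k \<le> F\<close> \<open>0 < 1 - s * k\<close> show ?thesis
      by (simp add: D)
  qed
qed

text \<open>With s = 1 - a, the divergence is squeezed between the Young gap integral, which tends
  to K, and k / (1 - s * k) when K is a finite k. For infinite K the lower bound alone
  suffices.\<close>

lemma renyi_divergence_one:
  assumes "sigma_finite_measure \<mu>" "P \<in> distributions \<mu>" "Q \<in> distributions \<mu>"
  shows "renyi_divergence \<mu> 1 P Q = enn2ereal (\<integral>\<^sup>+x. kl_integrand (pdf \<mu> P x) (pdf \<mu> Q x) \<partial>\<mu>)"
proof -
  define H where "H = (\<lambda>s. \<integral>\<^sup>+x. young_gap s (pdf \<mu> P x) (pdf \<mu> Q x) \<partial>\<mu>)"
  define K where "K = (\<integral>\<^sup>+x. kl_integrand (pdf \<mu> P x) (pdf \<mu> Q x) \<partial>\<mu>)"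
  have H: "(H \<longlongrightarrow> K) (at_right 0)"
    unfolding H_def K_def by (intro young_gap_integral_tendsto) auto
  have H_le: "H s \<le> K" if "0 < s" "s < 1" for s
    unfolding H_def K_def using that by (intro nn_integral_mono young_gap_le_kl_integrand) auto
  have ex: "\<exists>h\<ge>0. H s = ennreal h \<and> ennreal s * ennreal h + renyi_integral \<mu> (1 - s) P Q = 1"
    if "0 < s" "s < 1" for s
  proof -
    have "ennreal s * H s + renyi_integral \<mu> (1 - s) P Q = 1"
      unfolding H_def using assms that by (rule young_gap_renyi_integral)
    then show ?thesis
      using that by (cases "H s") (auto simp: ennreal_mult_top)
  qed
  have unit: "\<forall>\<^sub>F s in at_right (0::real). 0 < s \<and> s < 1"
    by (auto simp: eventually_at_right_field intro: exI[of _ 1])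
  have lower: "\<forall>\<^sub>F s in at_right 0. enn2ereal (H s) \<le> renyi_simple \<mu> (1 - s) P Q"
    using unit
  proof eventually_elim
    case (elim s)
    with ex[of s] obtain h where "0 \<le> h" "H s = ennreal h"
      "ennreal s * ennreal h + renyi_integral \<mu> (1 - s) P Q = 1" by auto
    with elim show ?case
      using renyi_simple_bounds(1)[of s h \<mu> P Q] by simp
  qed
  have "((\<lambda>s. renyi_simple \<mu> (1 - s) P Q) \<longlongrightarrow> enn2ereal K) (at_right 0)"
  proof (cases K)
    case (real k)
    have "((\<lambda>s. k / (1 - s * k)) \<longlongrightarrow> k / (1 - 0 * k)) (at_right 0)"
      by (intro tendsto_intros) auto
    then have upper_lim: "((\<lambda>s. ereal (k / (1 - s * k))) \<longlongrightarrow> enn2ereal K) (at_right 0)"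
      using real by simp
    have "((\<lambda>s. s * k) \<longlongrightarrow> 0 * k) (at_right 0)"
      by (intro tendsto_intros)
    then have "\<forall>\<^sub>F s in at_right 0. s * k < 1"
      by (rule order_tendstoD(2)) simp
    with unit have upper: "\<forall>\<^sub>F s in at_right 0. renyi_simple \<mu> (1 - s) P Q \<le> ereal (k / (1 - s * k))"
    proof eventually_elim
      case (elim s)
      with ex[of s] obtain h where h: "0 \<le> h" "H s = ennreal h"
        "ennreal s * ennreal h + renyi_integral \<mu> (1 - s) P Q = 1" by auto
      moreover have "h \<le> k"
        using H_le[of s] elim h real by simp
      ultimately show ?case
        using renyi_simple_bounds(2)[of s h \<mu> P Q k] elim by simp
    qed
    show ?thesis
      using lower upper by (rule tendsto_sandwich) (use H upper_lim in auto)
  next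
    case top
    show ?thesis
    proof (rule tendsto_sandwich[OF lower])
      show "\<forall>\<^sub>F s in at_right 0. renyi_simple \<mu> (1 - s) P Q \<le> \<infinity>" by simp
      show "((\<lambda>s. enn2ereal (H s)) \<longlongrightarrow> enn2ereal K) (at_right 0)"
        using H by simp
    qed (simp add: top)
  qed
  moreover have "filterlim (\<lambda>a::real. 1 - a) (at_right 0) (at_left 1)"
    by real_asymp
  ultimately have "((\<lambda>a. renyi_simple \<mu> (1 - (1 - a)) P Q) \<longlongrightarrow> enn2ereal K) (at_left 1)"
    by (rule filterlim_compose)
  then show ?thesis
    unfolding renyi_divergence_def K_def[symmetric]
    by (simp add: tendsto_Lim)
qed

section \<open>The Pythagorean inequality\<close>

lemma ext_ln_ennreal: "0 < x \<Longrightarrow> ext_ln (ennreal x) = ereal (ln x)"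
  by (simp add: ext_ln_def)

lemma ext_ln_le_iff: "ext_ln x \<le> ext_ln y \<longleftrightarrow> x \<le> y"
  by (cases x; cases y) (auto simp: ext_ln_def ennreal_le_iff2 top_unique)

lemma alpha_mixture_mem:
  assumes "alpha_convex \<mu> \<alpha> \<P>" "P \<in> \<P>" "R \<in> \<P>" "0 < t" "t < 1"
  shows "alpha_mixture \<mu> \<alpha> (1 - t) t R P \<in> \<P>"
  using assms by (auto simp: alpha_convex_def)

text \<open>Dividing by b isolates f / b, whose comparison with 1 is exactly the optimality of R;
  what remains is a bound on z in terms of the ratio a / b.\<close>

lemma mixture_normalisation:
  assumes "sigma_finite_measure \<mu>" "P \<in> distributions \<mu>" "R \<in> distributions \<mu>"
    and "0 < \<alpha>" "0 < t" "t < 1"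
    and "renyi_integral \<mu> \<alpha> P Q = ennreal a" "renyi_integral \<mu> \<alpha> R Q = ennreal b" "0 \<le> a" "0 < b"
  obtains z f where "0 < z"
    and "(\<integral>\<^sup>+x. power_mean \<alpha> t (pdf \<mu> R x) (pdf \<mu> P x) \<partial>\<mu>) = ennreal z"
    and "0 \<le> f" "renyi_integral \<mu> \<alpha> (alpha_mixture \<mu> \<alpha> (1 - t) t R P) Q = ennreal f"
    and "z powr \<alpha> * (f / b) = 1 + t * (a / b - 1)"
proof -
  obtain z where z: "0 < z" "(\<integral>\<^sup>+x. power_mean \<alpha> t (pdf \<mu> R x) (pdf \<mu> P x) \<partial>\<mu>) = ennreal z"
    and AE: "AE x in \<mu>. pdf \<mu> (alpha_mixture \<mu> \<alpha> (1 - t) t R P) x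
      = power_mean \<alpha> t (pdf \<mu> R x) (pdf \<mu> P x) / z"
    using assms(1-6) by (rule alpha_mixture_pdf)
  let ?F = "renyi_integral \<mu> \<alpha> (alpha_mixture \<mu> \<alpha> (1 - t) t R P) Q"
  have "ennreal (z powr \<alpha>) * ?F = ennreal ((1 - t) * b + t * a)"
    using renyi_integral_mixture[OF assms(4-6) z(1) AE, of Q] assms(5-10)
    by (simp flip: ennreal_mult ennreal_plus)
  moreover from this obtain f where f: "0 \<le> f" "?F = ennreal f"
    using z(1) by (cases ?F) (auto simp: ennreal_mult_top)
  ultimately have "ennreal (z powr \<alpha> * f) = ennreal ((1 - t) * b + t * a)"
    by (simp add: ennreal_mult)
  then have "z powr \<alpha> * f = (1 - t) * b + t * a"
    using f(1) assms(5-10) by (subst (asm) ennreal_inj) auto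
  then have "z powr \<alpha> * (f / b) = 1 + t * (a / b - 1)"
    using assms(10) by (simp add: field_simps)
  with z f that show ?thesis by blast
qed

lemma pythagorean_greater_one:
  assumes "sigma_finite_measure \<mu>" "1 < \<alpha>" "\<P> \<subseteq> distributions \<mu>" "alpha_convex \<mu> \<alpha> \<P>"
    and proj: "is_alpha_projection \<mu> \<alpha> \<P> Q R" and "P \<in> \<P>"
  shows "renyi_divergence \<mu> \<alpha> P R + renyi_divergence \<mu> \<alpha> R Q \<le> renyi_divergence \<mu> \<alpha> P Q"
proof (cases "renyi_integral \<mu> \<alpha> P Q")
  case top
  then show ?thesis
    using assms(2) by (simp add: renyi_divergence_def renyi_simple_def ext_ln_def)
next
  case (real a)
  \<comment> \<open>The prefactor 1 / (\<alpha> - 1) is positive, so R minimises the Renyi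
    integral.\<close>
  have opt: "renyi_integral \<mu> \<alpha> R Q \<le> renyi_integral \<mu> \<alpha> X Q" if "X \<in> \<P>" for X
    using proj that assms(2)
    by (auto simp: is_alpha_projection_def renyi_divergence_def renyi_simple_def
        ereal_mult_le_mult_iff ext_ln_le_iff)
  have "R \<in> \<P>" using proj by (simp add: is_alpha_projection_def)
  have dist: "P \<in> distributions \<mu>" "R \<in> distributions \<mu>"
    using assms \<open>R \<in> \<P>\<close> by auto
  obtain b where b: "0 < b" "renyi_integral \<mu> \<alpha> R Q = ennreal b"
    using opt[OF \<open>P \<in> \<P>\<close>] real renyi_integral_pos[OF assms(1) dist(2) assms(2), of Q]
    by (cases "renyi_integral \<mu> \<alpha> R Q") (auto simp: top_unique)
  have a: "0 < a"
    using renyi_integral_pos[OF assms(1) dist(1) assms(2), of Q] real by simp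
  have "renyi_integral \<mu> \<alpha> P R
      = (\<integral>\<^sup>+x. ennreal (pdf \<mu> P x powr \<alpha>) / ennreal (pdf \<mu> R x powr (\<alpha> - 1)) \<partial>\<mu>)"
    using assms(2) by (simp add: renyi_integral_def)
  also have "\<dots> \<le> ennreal (a / b)"
  proof (rule nn_integral_le_of_power_mean_le)
    fix t :: real
    assume t: "0 < t" "t < 1"
    obtain z f where z: "0 < z" "(\<integral>\<^sup>+x. power_mean \<alpha> t (pdf \<mu> R x) (pdf \<mu> P x) \<partial>\<mu>) = ennreal z"
      and f: "0 \<le> f" "renyi_integral \<mu> \<alpha> (alpha_mixture \<mu> \<alpha> (1 - t) t R P) Q = ennreal f"
        "z powr \<alpha> * (f / b) = 1 + t * (a / b - 1)"
      using mixture_normalisation[OF assms(1) dist _ t real(2) b(2) real(1) b(1)] assms(2) by auto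
    have "b \<le> f"
      using opt[OF alpha_mixture_mem[OF assms(4) \<open>P \<in> \<P>\<close> \<open>R \<in> \<P>\<close> t]] b f by simp
    then have "z powr \<alpha> * 1 \<le> z powr \<alpha> * (f / b)"
      using b by (intro mult_left_mono) auto
    \<comment> \<open>Optimality gives z powr \<alpha> \<le> 1 + t * (a / b - 1). The root is then
      linearised by Bernoulli's inequality with exponent 1 / \<alpha> below 1.\<close>
    then have "(z powr \<alpha>) powr (1 / \<alpha>) \<le> (1 + t * (a / b - 1)) powr (1 / \<alpha>)"
      using f(3) assms(2) by (intro powr_mono2) auto
    then have "z \<le> (1 + t * (a / b - 1)) powr (1 / \<alpha>)"
      using z assms(2) by (simp add: powr_powr)
    also have "\<dots> \<le> 1 + 1 / \<alpha> * ((1 + t * (a / b - 1)) - 1)"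
      using assms(2) b f by (intro powr_le_tangent) (auto simp flip: f(3))
    finally show "(\<integral>\<^sup>+x. power_mean \<alpha> t (pdf \<mu> R x) (pdf \<mu> P x) \<partial>\<mu>)
        \<le> ennreal (1 + t * ((a / b - 1) / \<alpha>))"
      using z by (simp add: ennreal_leI)
  qed (use assms dist in \<open>auto simp: nn_integral_pdf\<close>)
  finally have "renyi_integral \<mu> \<alpha> P R \<le> ennreal (a / b)" .
  then obtain g where g: "0 < g" "renyi_integral \<mu> \<alpha> P R = ennreal g" "g \<le> a / b"
    using renyi_integral_pos[OF assms(1) dist(1) assms(2), of R] a b
    by (cases "renyi_integral \<mu> \<alpha> P R") (auto simp: top_unique)
  have "ln g \<le> ln (a / b)"
    using g by simp
  then have "ln g + ln b \<le> ln a"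
    using a b by (simp add: ln_div)
  then have "(ln g + ln b) / (\<alpha> - 1) \<le> ln a / (\<alpha> - 1)"
    using assms(2) by (intro divide_right_mono) auto
  then show ?thesis
    using assms(2) a b g real
    by (simp add: renyi_divergence_def renyi_simple_def ext_ln_ennreal add_divide_distrib)
qed

lemma renyi_integral_le_one:
  assumes "sigma_finite_measure \<mu>" "P \<in> distributions \<mu>" "Q \<in> distributions \<mu>" "0 < \<alpha>" "\<alpha> < 1"
  shows "renyi_integral \<mu> \<alpha> P Q \<le> 1"
proof -
  \<comment> \<open>The nonnegative Young gap term fills the integral up to exactly 1.\<close>
  have "renyi_integral \<mu> \<alpha> P Q
      \<le> ennreal (1 - \<alpha>) * (\<integral>\<^sup>+x. young_gap (1 - \<alpha>) (pdf \<mu> P x) (pdf \<mu> Q x) \<partial>\<mu>)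
        + renyi_integral \<mu> \<alpha> P Q"
    by simp
  also have "\<dots> = 1"
    using young_gap_renyi_integral[OF assms(1-3), of "1 - \<alpha>"] assms(4,5) by simp
  finally show ?thesis .
qed

lemma pythagorean_less_one:
  assumes "sigma_finite_measure \<mu>" "0 < \<alpha>" "\<alpha> < 1" "\<P> \<subseteq> distributions \<mu>" "alpha_convex \<mu> \<alpha> \<P>"
    and "Q \<in> distributions \<mu>"
    and proj: "is_alpha_projection \<mu> \<alpha> \<P> Q R" and "P \<in> \<P>"
  shows "renyi_divergence \<mu> \<alpha> P R + renyi_divergence \<mu> \<alpha> R Q \<le> renyi_divergence \<mu> \<alpha> P Q"
proof (cases "renyi_integral \<mu> \<alpha> P Q = 0")
  case True
  then show ?thesis
    using assms(3) by (simp add: renyi_divergence_def renyi_simple_def ext_ln_def)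
next
  case False
  \<comment> \<open>The prefactor 1 / (\<alpha> - 1) is negative, so R maximises the Renyi integral;
    in particular b > 0 below follows from a > 0.\<close>
  have opt: "renyi_integral \<mu> \<alpha> X Q \<le> renyi_integral \<mu> \<alpha> R Q" if "X \<in> \<P>" for X
    using proj that assms(3)
    by (auto simp: is_alpha_projection_def renyi_divergence_def renyi_simple_def
        ereal_mult_le_mult_iff ext_ln_le_iff)
  have "R \<in> \<P>" using proj by (simp add: is_alpha_projection_def)
  have dist: "P \<in> distributions \<mu>" "R \<in> distributions \<mu>"
    using assms \<open>R \<in> \<P>\<close> by auto
  have le_one: "renyi_integral \<mu> \<alpha> P Q \<le> 1" "renyi_integral \<mu> \<alpha> R Q \<le> 1" "renyi_integral \<mu> \<alpha> P R \<le> 1"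
    using assms dist by (auto intro: renyi_integral_le_one)
  obtain a where a: "0 < a" "renyi_integral \<mu> \<alpha> P Q = ennreal a"
    using False le_one(1) by (cases "renyi_integral \<mu> \<alpha> P Q") (auto simp: top_unique less_le)
  obtain b where b: "0 < b" "renyi_integral \<mu> \<alpha> R Q = ennreal b"
    using opt[OF \<open>P \<in> \<P>\<close>] a le_one(2)
    by (cases "renyi_integral \<mu> \<alpha> R Q") (auto simp: top_unique)
  have "ennreal (a / b)
      \<le> (\<integral>\<^sup>+x. ennreal (pdf \<mu> P x powr \<alpha> * pdf \<mu> R x powr (1 - \<alpha>)) \<partial>\<mu>)"
  proof (rule nn_integral_ge_of_power_mean_ge)
    fix t :: real
    assume t: "0 < t" "t < 1"
    obtain z f where z: "0 < z" "(\<integral>\<^sup>+x. power_mean \<alpha> t (pdf \<mu> R x) (pdf \<mu> P x) \<partial>\<mu>) = ennreal z"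
      and f: "0 \<le> f" "renyi_integral \<mu> \<alpha> (alpha_mixture \<mu> \<alpha> (1 - t) t R P) Q = ennreal f"
        "z powr \<alpha> * (f / b) = 1 + t * (a / b - 1)"
      using mixture_normalisation[OF assms(1) dist assms(2) t a(2) b(2) _ b(1)] a(1) by auto
    have "f \<le> b"
      using opt[OF alpha_mixture_mem[OF assms(5) \<open>P \<in> \<P>\<close> \<open>R \<in> \<P>\<close> t]] b f by simp
    then have le: "z powr \<alpha> * (f / b) \<le> z powr \<alpha> * 1"
      using b by (intro mult_left_mono) auto
    \<comment> \<open>The exponent 1 / \<alpha> exceeds 1, so the opposite Bernoulli inequality
      applies, matching the reversed bound f \<le> b.\<close>
    have "1 + 1 / \<alpha> * ((1 + t * (a / b - 1)) - 1) \<le> (1 + t * (a / b - 1)) powr (1 / \<alpha>)"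
      using assms(2,3) b f by (intro powr_ge_tangent) (auto simp flip: f(3))
    also have "\<dots> \<le> (z powr \<alpha>) powr (1 / \<alpha>)"
      using le assms(2) b(1) f(1) by (intro powr_mono2) (auto simp flip: f(3))
    also have "\<dots> = z"
      using z assms(2) by (simp add: powr_powr)
    finally show "ennreal (1 + t * ((a / b - 1) / \<alpha>))
        \<le> (\<integral>\<^sup>+x. power_mean \<alpha> t (pdf \<mu> R x) (pdf \<mu> P x) \<partial>\<mu>)"
      using z by (simp add: ennreal_leI)
  qed (use assms dist a b in \<open>auto simp: nn_integral_pdf\<close>)
  also have "\<dots> = renyi_integral \<mu> \<alpha> P R"
    using assms(3) by (simp add: renyi_integral_def)
  finally have "ennreal (a / b) \<le> renyi_integral \<mu> \<alpha> P R" .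
  then obtain g where g: "renyi_integral \<mu> \<alpha> P R = ennreal g" "a / b \<le> g"
    using le_one(3) by (cases "renyi_integral \<mu> \<alpha> P R") (auto simp: top_unique)
  have "0 < a / b" using a b by simp
  then have "0 < g" "ln (a / b) \<le> ln g"
    using g(2) by auto
  then have "ln a \<le> ln g + ln b"
    using a b by (simp add: ln_div)
  then have "(ln g + ln b) / (\<alpha> - 1) \<le> ln a / (\<alpha> - 1)"
    using assms(3) by (intro divide_right_mono_neg) auto
  then show ?thesis
    using assms(3) a b g \<open>0 < g\<close>
    by (simp add: renyi_divergence_def renyi_simple_def ext_ln_ennreal add_divide_distrib)
qed

lemma pythagorean_one:
  assumes "sigma_finite_measure \<mu>" "\<P> \<subseteq> distributions \<mu>" "alpha_convex \<mu> 1 \<P>"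
    and "Q \<in> distributions \<mu>"
    and proj: "is_alpha_projection \<mu> 1 \<P> Q R" and "P \<in> \<P>"
  shows "renyi_divergence \<mu> 1 P R + renyi_divergence \<mu> 1 R Q \<le> renyi_divergence \<mu> 1 P Q"
proof -
  define K where "K = (\<lambda>X Y. \<integral>\<^sup>+x. kl_integrand (pdf \<mu> X x) (pdf \<mu> Y x) \<partial>\<mu>)"
  have "R \<in> \<P>" using proj by (simp add: is_alpha_projection_def)
  have dist: "P \<in> distributions \<mu>" "R \<in> distributions \<mu>"
    using assms \<open>R \<in> \<P>\<close> by auto
  have div: "renyi_divergence \<mu> 1 X Y = enn2ereal (K X Y)"
    if "X \<in> distributions \<mu>" "Y \<in> distributions \<mu>" for X Y
    unfolding K_def using assms(1) that by (rule renyi_divergence_one)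
  have opt: "K R Q \<le> K X Q" if "X \<in> \<P>" for X
  proof -
    have "X \<in> distributions \<mu>" using that assms(2) by blast
    moreover have "renyi_divergence \<mu> 1 R Q \<le> renyi_divergence \<mu> 1 X Q"
      using proj that by (simp add: is_alpha_projection_def)
    ultimately show ?thesis
      using dist(2) assms(4) by (simp add: div less_eq_ennreal.rep_eq)
  qed
  show ?thesis
  proof (cases "K P Q")
    case top
    then show ?thesis
      using div[OF dist(1) assms(4)] by simp
  next
    case (real a)
    then obtain b where b: "0 \<le> b" "K R Q = ennreal b" "b \<le> a"
      using opt[OF \<open>P \<in> \<P>\<close>] by (cases "K R Q") (auto simp: top_unique)
    define m where "m = (\<lambda>t x. (1 - t) * pdf \<mu> R x + t * pdf \<mu> P x)"
    have [measurable]: "m t \<in> borel_measurable \<mu>" for t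
      unfolding m_def by measurable
    have "K P R \<le> ennreal (a - b)"
      unfolding K_def
    proof (rule nn_integral_le_at_right)
      show "(\<lambda>x. kl_integrand (pdf \<mu> P x) (m t x)) \<in> borel_measurable \<mu>" for t
        by measurable
      show "((\<lambda>t. kl_integrand (pdf \<mu> P x) (m t x)) \<longlongrightarrow> kl_integrand (pdf \<mu> P x) (pdf \<mu> R x)) (at_right 0)"
        for x
        unfolding m_def by (intro kl_integrand_tendsto) auto
    next
      fix t :: real
      assume t: "0 < t" "t < 1"
      obtain z where z: "0 < z" "(\<integral>\<^sup>+x. power_mean 1 t (pdf \<mu> R x) (pdf \<mu> P x) \<partial>\<mu>) = ennreal z"
        and AE: "AE x in \<mu>. pdf \<mu> (alpha_mixture \<mu> 1 (1 - t) t R P) x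
          = power_mean 1 t (pdf \<mu> R x) (pdf \<mu> P x) / z"
        using assms(1) dist zero_less_one t by (rule alpha_mixture_pdf)
      have mean: "power_mean 1 t (pdf \<mu> R x) (pdf \<mu> P x) = m t x" for x
        using t by (simp add: power_mean_one m_def)
      \<comment> \<open>For order 1 the mean is the chord itself, which is already
        normalised.\<close>
      have "ennreal z = (\<integral>\<^sup>+x. ennreal (1 - t) * ennreal (pdf \<mu> R x) + ennreal t * ennreal (pdf \<mu> P x) \<partial>\<mu>)"
        unfolding z(2)[symmetric] mean m_def using t
        by (intro nn_integral_cong) (simp flip: ennreal_mult ennreal_plus)
      also have "\<dots> = 1"
        using assms(1) dist t
        by (simp add: nn_integral_add nn_integral_cmult nn_integral_pdf flip: ennreal_plus)
      finally have "z = 1" by simp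
      define U where "U = (\<integral>\<^sup>+x. kl_integrand (pdf \<mu> P x) (m t x) \<partial>\<mu>)"
      have "K R Q \<le> K (alpha_mixture \<mu> 1 (1 - t) t R P) Q"
        by (intro opt alpha_mixture_mem assms(3,6) \<open>R \<in> \<P>\<close> t)
      also have "\<dots> = (\<integral>\<^sup>+x. kl_integrand (m t x) (pdf \<mu> Q x) \<partial>\<mu>)"
        unfolding K_def
        by (rule nn_integral_cong_AE, use AE in eventually_elim) (simp add: mean \<open>z = 1\<close>)
      finally have "K R Q + ennreal t * U
          \<le> (\<integral>\<^sup>+x. kl_integrand (m t x) (pdf \<mu> Q x) \<partial>\<mu>) + ennreal t * U"
        by (rule add_right_mono)
      also have "\<dots> = (\<integral>\<^sup>+x. kl_integrand (m t x) (pdf \<mu> Q x)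
          + ennreal t * kl_integrand (pdf \<mu> P x) (m t x) \<partial>\<mu>)"
        unfolding U_def by (simp add: nn_integral_add nn_integral_cmult)
      also have "\<dots> \<le> (\<integral>\<^sup>+x. ennreal (1 - t) * kl_integrand (pdf \<mu> R x) (pdf \<mu> Q x)
          + ennreal t * kl_integrand (pdf \<mu> P x) (pdf \<mu> Q x) \<partial>\<mu>)"
        unfolding m_def using t by (intro nn_integral_mono kl_integrand_compensation) auto
      also have "\<dots> = ennreal (1 - t) * K R Q + ennreal t * K P Q"
        unfolding K_def by (simp add: nn_integral_add nn_integral_cmult)
      finally have *: "ennreal b + ennreal t * U \<le> ennreal ((1 - t) * b + t * a)"
        using real b t by (simp flip: ennreal_mult ennreal_plus)
      \<comment> \<open>The finite b is cancelled and the rest divided by t, which removes t from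
        the bound and allows the passage to t = 0.\<close>
      have "U \<le> ennreal (a - b)"
      proof (cases U)
        case (real u)
        with * b t \<open>0 \<le> a\<close> have "b + t * u \<le> (1 - t) * b + t * a"
          by (simp add: ennreal_le_iff flip: ennreal_mult ennreal_plus)
        then have "t * u \<le> t * (a - b)"
          by (simp add: algebra_simps)
        with t real show ?thesis by (simp add: ennreal_leI)
      qed (use * t in \<open>simp add: ennreal_mult_top top_unique\<close>)
      then show "(\<integral>\<^sup>+x. kl_integrand (pdf \<mu> P x) (m t x) \<partial>\<mu>) \<le> ennreal (a - b)"
        by (simp add: U_def)
    qed
    then have "K P R + K R Q \<le> ennreal (a - b) + ennreal b"
      unfolding b(2) by (rule add_right_mono)
    also have "\<dots> = K P Q"
      using b real by (simp flip: ennreal_plus)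
    finally show ?thesis
      using div dist assms(4) by (simp add: less_eq_ennreal.rep_eq plus_ennreal.rep_eq)
  qed
qed

theorem theorem14:
  fixes \<mu> :: "'a measure" and \<alpha> :: real
    and \<P> :: "'a measure set" and Q Pstar :: "'a measure"
  assumes "sigma_finite_measure \<mu>"
    and "0 < \<alpha>"
    and "\<P> \<subseteq> distributions \<mu>"
    and "alpha_convex \<mu> \<alpha> \<P>"
    and "Q \<in> distributions \<mu>"
    and "is_alpha_projection \<mu> \<alpha> \<P> Q Pstar"
  shows "\<forall>P\<in>\<P>. renyi_divergence \<mu> \<alpha> P Q
                  \<ge> renyi_divergence \<mu> \<alpha> P Pstar + renyi_divergence \<mu> \<alpha> Pstar Q"
proof -
  consider "\<alpha> < 1" | "\<alpha> = 1" | "1 < \<alpha>" by linarith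
  then show ?thesis
    using assms
    by cases (auto intro: pythagorean_less_one pythagorean_one pythagorean_greater_one)
qed

end
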